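(* Let $F$ be a singular fiber of Kodaira type $I_n^*$, $n\geq1$, of an elliptic fibration on a smooth $K3$ surface, written $$F=C_0'+C_0''+2C_0+2C_1+\cdots+2C_n+C_n'+C_n''.$$ Let $R$ be an ADER in $F$ with $C_0\subset\operatorname{Supp}(R)$ and $C_n\not\subset\operatorname{Supp}(R)$. Let $\Gamma_L$ be the connected component of $R$ containing $C_0$, put $c_L:=\#(\operatorname{Supp}(\Gamma_L)\cap\{C_0,\dots,C_n\})$ (the number of the $C_i$ contained in $\Gamma_L$), and write $$R=\Gamma_L+R_M+B_R,$$ where $R_M$ is the remaining part of $R$ on the central chain, supported on $C_{c_L+1}-C_{c_L+2}-\cdots-C_{n-1}$, and $B_R\in\{0,\,C_n',\,C_n'',\,C_n'+C_n''\}$ is the part of $R$ supported on the right leaves. Then $R_M$ is either zero or of type $A_{\lambda_1}\oplus\cdots\oplus A_{\lambda_r}$ for some $\lambda_1,\dots,\lambda_r\geq1$ satisfying $$\sum_{i=1}^r\lambda_i+r\leq n-c_L.$$ Moreover, $\Gamma_L$ is one of the following. (1) $\Gamma_L=C_0+C_1+\cdots+C_{p-1}$ for some $1\leq p\leq n$; then $\Gamma_L$ is of type $A_p$. (2) $\Gamma_L=L+C_0+C_1+\cdots+C_{p-1}$ for some $L\in\{C_0',C_0''\}$ and $1\leq p\leq n$; then $\Gamma_L$ is of type $A_{p+1}$. (3) $\Gamma_L=C_0'+C_0+C_0''$; then $\Gamma_L$ is of type $A_3^{\mathrm{sp}}$. (4) $\Gamma_L=C_0'+C_0''+C_0+C_1+\cdots+C_{p-1}$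 for some $2\leq p\leq n$; then $\Gamma_L$ is of type $D_{p+2}$. In cases (1), (2), (4) one has $c_L=p$, while in case (3) one has $c_L=1$. Conversely, every reduced subdivisor of $F$ of the form $\Gamma_L+R_M+B_R$, with $\Gamma_L$ as in one of (1)–(4) (and $c_L$ the number of the $C_i$ contained in it), $R_M$ zero or a disjoint union of consecutive subchains (pairwise separated by at least one unused vertex) of $C_{c_L+1}-\cdots-C_{n-1}$, of type $A_{\lambda_1}\oplus\cdots\oplus A_{\lambda_r}$ with $\sum_{i=1}^r\lambda_i+r\leq n-c_L$ if nonzero, and $B_R\in\{0,\,C_n',\,C_n'',\,C_n'+C_n''\}$, is an ADER.
   Context: We work over an algebraically closed field of characteristic $0$. In a fiber of type $I_n^*$ ($n\ge1$) all components are smooth rational $(-2)$-curves, meeting transversely in at most one point, with dual graph $\widetilde D_{n+4}$: $C_0-C_1-\cdots-C_n$ is a chain (the central chain), the leaves $C_0',C_0''$ are attached to $C_0$ and the (right) leaves $C_n',C_n''$ to $C_n$. The chain $C_{c_L+1}-\cdots-C_{n-1}$ is empty if $c_L\geq n-1$. An ADE reduced divisor (ADER) in $F$ is a reduced subdivisor of $F$ (a sum of distinct components) whose dual graph is a disjoint union of Dynkin diagrams of type $A_k$, $D_l$ ($l\ge4$), $E_6,E_7,E_8$; its type is the type of this graph, with $\oplus$ denoting disjoint union. $A_3^{\mathrm{sp}}$ denotes the special configuration $C_0'+C_0+C_0''$ at the left end (or $C_n'+C_n+C_n''$ at the right end), whose Dynkin type is $A_3$. *)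

theory Defs
  imports
    "Graph_Theory.Graph_Theory"
    "HOL-Library.Multiset"
begin

text \<open>
  The irreducible curves on the surface form the type \<open>'c\<close>, and \<open>dot D E\<close> is the intersection
  number of two curves.  Effective divisors are finite multisets of curves, so \<open>+\<close> is the sum of
  divisors, \<open>\<subseteq>#\<close> is the relation of being a subdivisor and \<open>set_mset\<close> is the support.
  Undirected graphs are the symmetric ones among the \<open>pair_pre_digraph\<close>s of \<open>Graph_Theory\<close>.
\<close>

definition reduced :: "'c multiset \<Rightarrow> bool" where
  "reduced R \<longleftrightarrow> (\<forall>D. count R D \<le> 1)"

text \<open>The divisors considered here have components that meet transversely in at most one point,
  so their dual graphs have no multiple edges.\<close>

definition dual_graph :: "('c \<Rightarrow> 'c \<Rightarrow> int) \<Rightarrow> 'c multiset \<Rightarrow> 'c pair_pre_digraph" where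
  "dual_graph dot R =
     \<lparr> pverts = set_mset R,
       parcs = {(D, E). D \<in># R \<and> E \<in># R \<and> D \<noteq> E \<and> dot D E \<ge> 1} \<rparr>"

text \<open>The dual graph is symmetric, so its strongly connected components are its connected
  components.\<close>

definition component_of :: "('c \<Rightarrow> 'c \<Rightarrow> int) \<Rightarrow> 'c multiset \<Rightarrow> 'c \<Rightarrow> 'c multiset" where
  "component_of dot R D =
     filter_mset (\<lambda>E. E \<in> pre_digraph.scc_of (with_proj (dual_graph dot R)) D) R"

definition undirected :: "'v set \<Rightarrow> ('v \<times> 'v) set \<Rightarrow> 'v pair_pre_digraph" where
  "undirected V Es = \<lparr> pverts = V, parcs = Es \<union> Es\<inverse> \<rparr>"

datatype dynkin = DynA nat | DynD nat | DynE nat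

fun valid_dynkin :: "dynkin \<Rightarrow> bool" where
  "valid_dynkin (DynA k) \<longleftrightarrow> k \<ge> 1"
| "valid_dynkin (DynD l) \<longleftrightarrow> l \<ge> 4"
| "valid_dynkin (DynE m) \<longleftrightarrow> m \<in> {6, 7, 8}"

text \<open>In type D and E the vertices \<open>0, \<dots>, m - 2\<close> form a path and the last vertex \<open>m - 1\<close> is
  attached to the last but one vertex of the path (type D) or to its third vertex (type E).\<close>

fun dynkin_graph :: "dynkin \<Rightarrow> nat pair_pre_digraph" where
  "dynkin_graph (DynA k) = undirected {..<k} {(i, Suc i) | i. Suc i < k}"
| "dynkin_graph (DynD l) =
     undirected {..<l} ({(i, Suc i) | i. Suc i < l - 1} \<union> {(l - 3, l - 1)})"
| "dynkin_graph (DynE m) =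
     undirected {..<m} ({(i, Suc i) | i. Suc i < m - 1} \<union> {(2, m - 1)})"

definition disjoint_union :: "'v pair_pre_digraph list \<Rightarrow> (nat \<times> 'v) pair_pre_digraph" where
  "disjoint_union Gs =
     \<lparr> pverts = {(i, v). i < length Gs \<and> v \<in> pverts (Gs ! i)},
       parcs = {((i, v), (j, w)). i < length Gs \<and> j = i \<and> (v, w) \<in> parcs (Gs ! i)} \<rparr>"

text \<open>\<open>of_type dot R [t\<^sub>1, \<dots>, t\<^sub>r]\<close> says that \<open>R\<close> has type \<open>t\<^sub>1 \<oplus> \<dots> \<oplus> t\<^sub>r\<close>.\<close>

definition of_type :: "('c \<Rightarrow> 'c \<Rightarrow> int) \<Rightarrow> 'c multiset \<Rightarrow> dynkin list \<Rightarrow> bool" where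
  "of_type dot R ts \<longleftrightarrow>
     (\<forall>t \<in> set ts. valid_dynkin t) \<and>
     digraph_iso (with_proj (dual_graph dot R))
       (with_proj (disjoint_union (map dynkin_graph ts)))"

definition ADER :: "('c \<Rightarrow> 'c \<Rightarrow> int) \<Rightarrow> 'c multiset \<Rightarrow> 'c multiset \<Rightarrow> bool" where
  "ADER dot F R \<longleftrightarrow> R \<subseteq># F \<and> reduced R \<and> (\<exists>ts. of_type dot R ts)"

text \<open>\<open>chain C a l\<close> is the sum of the \<open>l\<close> consecutive curves \<open>C a, \<dots>, C (a + l - 1)\<close>.\<close>

definition chain :: "(nat \<Rightarrow> 'c) \<Rightarrow> nat \<Rightarrow> nat \<Rightarrow> 'c multiset" where
  "chain C a l = image_mset C (mset [a..<a + l])"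

text \<open>\<open>F\<close> is a fiber of type \<open>I\<^sub>n\<^sup>*\<close> with central chain \<open>C 0, \<dots>, C n\<close>, left leaves \<open>C0'\<close>, \<open>C0''\<close>
  and right leaves \<open>Cn'\<close>, \<open>Cn''\<close>.  The ambient surface enters only through the intersection
  numbers of its curves.\<close>

definition I_star_fiber ::
  "('c \<Rightarrow> 'c \<Rightarrow> int) \<Rightarrow> nat \<Rightarrow> (nat \<Rightarrow> 'c) \<Rightarrow> 'c \<Rightarrow> 'c \<Rightarrow> 'c \<Rightarrow> 'c \<Rightarrow> 'c multiset \<Rightarrow> bool" where
  "I_star_fiber dot n C C0' C0'' Cn' Cn'' F \<longleftrightarrow>
     n \<ge> 1 \<and>
     (\<forall>D E. dot D E = dot E D) \<and>
     distinct ([C0', C0''] @ map C [0..<Suc n] @ [Cn', Cn'']) \<and>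
     F = {#C0', C0''#} + repeat_mset 2 (chain C 0 (Suc n)) + {#Cn', Cn''#} \<and>
     (\<forall>D \<in># F. dot D D = -2) \<and>
     (\<forall>D \<in># F. \<forall>E \<in># F. D \<noteq> E \<longrightarrow> dot D E \<in> {0, 1}) \<and>
     dual_graph dot F =
       undirected (set_mset F)
         ({(C i, C (Suc i)) | i. i < n} \<union> {(C0', C 0), (C0'', C 0), (C n, Cn'), (C n, Cn'')})"

definition central_count :: "(nat \<Rightarrow> 'c) \<Rightarrow> nat \<Rightarrow> 'c multiset \<Rightarrow> nat" where
  "central_count C n R = card (set_mset R \<inter> C ` {0..n})"

definition A3_special ::
  "nat \<Rightarrow> (nat \<Rightarrow> 'c) \<Rightarrow> 'c \<Rightarrow> 'c \<Rightarrow> 'c \<Rightarrow> 'c \<Rightarrow> 'c multiset \<Rightarrow> bool" where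
  "A3_special n C C0' C0'' Cn' Cn'' R \<longleftrightarrow>
     R = {#C0', C 0, C0''#} \<or> R = {#Cn', C n, Cn''#}"

text \<open>\<open>R\<close> is the sum of consecutive subchains of \<open>C lo, \<dots>, C (hi - 1)\<close>, of lengths \<open>ls\<close> and with
  first indices \<open>as\<close>, any two of them separated by at least one unused vertex.\<close>

definition separated_subchains ::
  "(nat \<Rightarrow> 'c) \<Rightarrow> nat \<Rightarrow> nat \<Rightarrow> nat list \<Rightarrow> 'c multiset \<Rightarrow> bool" where
  "separated_subchains C lo hi ls R \<longleftrightarrow>
     (\<exists>as. length as = length ls \<and>
       (\<forall>i < length ls. ls ! i \<ge> 1 \<and> lo \<le> as ! i \<and> as ! i + ls ! i \<le> hi) \<and>
       (\<forall>i < length ls. \<forall>j < length ls. i \<noteq> j \<longrightarrow>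
          as ! i + ls ! i < as ! j \<or> as ! j + ls ! j < as ! i) \<and>
       R = (\<Sum>i < length ls. chain C (as ! i) (ls ! i)))"

end

theory Submission
  imports Defs
begin

text \<open>
  If \<open>p\<close> is the least index with \<open>C p\<close> not in \<open>R\<close>, the component of \<open>C 0\<close> consists of
  \<open>C 0, \<dots>, C (p - 1)\<close> and the left leaves in \<open>R\<close>: no arc leaves this set, because \<open>C p\<close> is missing
  and \<open>p \<le> n\<close> keeps it away from the right leaves.  The four cases record which left leaves occur.
  Conversely, the three parts have Dynkin types and no arcs run between them.
\<close>

section \<open>Types of dual graphs\<close>

text \<open>\<open>of_type\<close> asks for a \<open>digraph_iso\<close>, that is, a record of maps
  on vertices, arcs, heads and tails, into a graph with tagged vertices. Arcs here are pairs of
  vertices, so the vertex map determines the rest, and a type amounts to a bijection that preserves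
  and reflects adjacency. Each possible part then gets an explicit labelling, and types of mutually
  orthogonal parts are added by concatenating lists of Dynkin symbols. Both directions meet in the
  predicate \<open>left_part p\<close>, with \<open>p\<close> the number of central curves. Two left
  leaves with \<open>C 0\<close> alone form a path; only from \<open>p = 2\<close> on does
  \<open>C 0\<close> have three neighbours, which is why type D starts there and the case
  \<open>p = 1\<close> is separate. The missing curves \<open>C p\<close> and \<open>C n\<close>
  leave the \<open>n - p - 1\<close> curves \<open>C (p + 1), ..., C (n - 1)\<close> for the middle
  part. If it has r blocks, they need r - 1 gaps, so the lengths and gaps together are at most
  \<open>n - p - 1\<close>; adding 1 gives the stated bound.\<close>

lemma digraph_iso_with_proj_iff:
  assumes "pair_wf_digraph G" "pair_wf_digraph H"
  shows "digraph_iso (with_proj G) (with_proj H) \<longleftrightarrow>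
    (\<exists>h. bij_betw h (pverts G) (pverts H) \<and>
      (\<forall>u\<in>pverts G. \<forall>v\<in>pverts G. (u, v) \<in> parcs G \<longleftrightarrow> (h u, h v) \<in> parcs H))"
    (is "?L \<longleftrightarrow> ?R")
proof
  assume ?L
  then obtain f where iso: "pre_digraph.digraph_isomorphism (with_proj G) f"
    and H: "with_proj H = app_iso f (with_proj G)"
    unfolding digraph_iso_def by blast
  let ?h = "iso_verts f"
  have pv: "pverts H = ?h ` pverts G" and pa: "parcs H = iso_arcs f ` parcs G"
    and tl: "iso_tail f = fst" and hd: "iso_head f = snd"
    using arg_cong[OF H, of verts] arg_cong[OF H, of arcs]
      arg_cong[OF H, of tail] arg_cong[OF H, of head] by simp_all
  have inj: "inj_on ?h (pverts G)"
    using iso by (simp add: pre_digraph.digraph_isomorphism_def)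
  \<comment> \<open>Heads and tails on both sides are the projections \<open>snd\<close> and
    \<open>fst\<close>, so compatibility with them fixes both coordinates of the image arc.\<close>
  have "iso_arcs f a = map_prod ?h ?h a" if "a \<in> parcs G" for a
    using iso that tl hd by (cases a) (auto simp: pre_digraph.digraph_isomorphism_def prod_eq_iff)
  then have pa': "parcs H = map_prod ?h ?h ` parcs G"
    unfolding pa by (intro image_cong) auto
  \<comment> \<open>Arcs are reflected because a preimage arc has its ends in
    \<open>pverts G\<close>, where the vertex map is injective.\<close>
  have "(u, v) \<in> parcs G" if "u \<in> pverts G" "v \<in> pverts G" "(?h u, ?h v) \<in> parcs H" for u v
  proof -
    from that(3) obtain u' v' where uv: "(u', v') \<in> parcs G" "?h u' = ?h u" "?h v' = ?h v"
      unfolding pa' by auto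
    then have "u' \<in> pverts G" "v' \<in> pverts G"
      using pair_wf_digraph.wellformed'[OF assms(1)] by blast+
    then show ?thesis using uv that(1,2) inj by (auto dest: inj_onD)
  qed
  then have "\<forall>u\<in>pverts G. \<forall>v\<in>pverts G. (u, v) \<in> parcs G \<longleftrightarrow> (?h u, ?h v) \<in> parcs H"
    unfolding pa' by force
  with inj pv show ?R by (auto simp: bij_betw_def)
next
  assume ?R
  then obtain h where bij: "bij_betw h (pverts G) (pverts H)"
    and arc: "\<And>u v. u \<in> pverts G \<Longrightarrow> v \<in> pverts G \<Longrightarrow> (u, v) \<in> parcs G \<longleftrightarrow> (h u, h v) \<in> parcs H"
    by blast
  define f where "f = \<lparr>iso_verts = h, iso_arcs = map_prod h h, iso_head = snd, iso_tail = fst\<rparr>"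
  have sub: "parcs G \<subseteq> pverts G \<times> pverts G"
    using pair_wf_digraph.wellformed'[OF assms(1)] by auto
  have inj: "inj_on h (pverts G)" and im: "h ` pverts G = pverts H"
    using bij by (auto simp: bij_betw_def)
  have "inj_on (map_prod h h) (parcs G)"
    using map_prod_inj_on[OF inj inj] sub by (rule inj_on_subset)
  then have iso: "pre_digraph.digraph_isomorphism (with_proj G) f"
    using assms(1) inj by (simp add: pre_digraph.digraph_isomorphism_def f_def wf_digraph_wp_iff)
  have "parcs H = map_prod h h ` parcs G"
  proof (intro equalityI subsetI)
    fix a assume a: "a \<in> parcs H"
    then have "fst a \<in> h ` pverts G" "snd a \<in> h ` pverts G"
      using im pair_wf_digraph.arc_fst_in_verts[OF assms(2)] pair_wf_digraph.arc_snd_in_verts[OF assms(2)]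
      by auto
    then obtain u v where "u \<in> pverts G" "v \<in> pverts G" "a = (h u, h v)"
      by (metis imageE prod.collapse)
    with a arc show "a \<in> map_prod h h ` parcs G" by force
  qed (use sub arc in auto)
  then have "with_proj H = app_iso f (with_proj G)"
    using im by (simp add: app_iso_def f_def with_proj_def)
  with iso show ?L unfolding digraph_iso_def by blast
qed

lemma pair_wf_digraph_undirected:
  assumes "Es \<subseteq> V \<times> V"
  shows "pair_wf_digraph (undirected V Es)"
  using assms by unfold_locales (auto simp: undirected_def)

text \<open>Validity keeps the truncated differences \<open>l - 3\<close>, \<open>l - 1\<close>,
  \<open>m - 1\<close> and the branch vertex 2 inside the vertex set.\<close>

lemma pair_wf_digraph_dynkin_graph:
  assumes "valid_dynkin t"
  shows "pair_wf_digraph (dynkin_graph t)"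
  using assms by (cases t) (auto intro!: pair_wf_digraph_undirected)

lemma pair_wf_digraph_disjoint_union:
  assumes "\<And>G. G \<in> set Gs \<Longrightarrow> pair_wf_digraph G"
  shows "pair_wf_digraph (disjoint_union Gs)"
  using pair_wf_digraph.wellformed'[OF assms[OF nth_mem]]
  by unfold_locales (auto simp: disjoint_union_def)

lemma pair_wf_digraph_dual_graph: "pair_wf_digraph (dual_graph dot R)"
  by unfold_locales (auto simp: dual_graph_def)

lemma of_type_iff:
  "of_type dot R ts \<longleftrightarrow> (\<forall>t \<in> set ts. valid_dynkin t) \<and>
    (\<exists>h. bij_betw h (set_mset R) (pverts (disjoint_union (map dynkin_graph ts))) \<and>
      (\<forall>D\<in>#R. \<forall>E\<in>#R. D \<noteq> E \<and> dot D E \<ge> 1 \<longleftrightarrow>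
        (h D, h E) \<in> parcs (disjoint_union (map dynkin_graph ts))))"
proof (cases "\<forall>t \<in> set ts. valid_dynkin t")
  case True
  then have "pair_wf_digraph (disjoint_union (map dynkin_graph ts))"
    by (intro pair_wf_digraph_disjoint_union) (auto intro: pair_wf_digraph_dynkin_graph)
  from digraph_iso_with_proj_iff[OF pair_wf_digraph_dual_graph this, of dot R] True
  show ?thesis unfolding of_type_def by (simp add: dual_graph_def)
qed (auto simp: of_type_def)

lemma of_type_Nil: "of_type dot R [] \<longleftrightarrow> R = {#}"
  by (auto simp: of_type_iff disjoint_union_def bij_betw_def)

text \<open>The labelling runs from the numbered model to the curves, opposite to
  \<open>of_type_iff\<close>, since a function on numbers is easy to write down. Its inverse, tagged
  with 0, is the required isomorphism.\<close>

lemma of_type_single: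
  assumes "valid_dynkin t"
    and "bij_betw f (pverts (dynkin_graph t)) (set_mset R)"
    and "\<And>i j. i \<in> pverts (dynkin_graph t) \<Longrightarrow> j \<in> pverts (dynkin_graph t) \<Longrightarrow>
      (i, j) \<in> parcs (dynkin_graph t) \<longleftrightarrow> f i \<noteq> f j \<and> dot (f i) (f j) \<ge> 1"
  shows "of_type dot R [t]"
proof -
  let ?V = "pverts (dynkin_graph t)"
  let ?g = "the_inv_into ?V f"
  have bij: "bij_betw ?g (set_mset R) ?V"
    using assms(2) by (rule bij_betw_the_inv_into)
  have fg: "f (?g D) = D" if "D \<in># R" for D
    using assms(2) that by (auto simp: bij_betw_def f_the_inv_into_f)
  have gV: "?g D \<in> ?V" if "D \<in># R" for D
    using bij that by (auto simp: bij_betw_def)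
  have "bij_betw (\<lambda>D. (0 :: nat, ?g D)) (set_mset R) ({0} \<times> ?V)"
    using bij by (auto simp: bij_betw_def inj_on_def)
  moreover have "{0} \<times> ?V = pverts (disjoint_union [dynkin_graph t])"
    by (auto simp: disjoint_union_def)
  moreover have "D \<noteq> E \<and> dot D E \<ge> 1 \<longleftrightarrow>
      ((0, ?g D), (0, ?g E)) \<in> parcs (disjoint_union [dynkin_graph t])" if "D \<in># R" "E \<in># R" for D E
    using assms(3)[OF gV gV, OF that] that by (simp add: disjoint_union_def fg)
  ultimately show ?thesis
    using assms(1) unfolding of_type_iff by auto
qed

text \<open>Arcs of \<open>disjoint_union\<close> join only vertices with equal tags. Shifting the
  tags of the second family past those of the first makes cross pairs nonadjacent, which matches the
  orthogonality of \<open>A\<close> and \<open>B\<close>.\<close>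

lemma of_type_append:
  assumes A: "of_type dot A ss" and B: "of_type dot B ts"
    and disj: "set_mset A \<inter> set_mset B = {}"
    and orth: "\<And>D E. D \<in># A \<Longrightarrow> E \<in># B \<Longrightarrow> dot D E < 1 \<and> dot E D < 1"
  shows "of_type dot (A + B) (ss @ ts)"
proof -
  let ?U = "\<lambda>ts. disjoint_union (map dynkin_graph ts)"
  obtain f where f: "bij_betw f (set_mset A) (pverts (?U ss))"
    and fa: "\<And>D E. D \<in># A \<Longrightarrow> E \<in># A \<Longrightarrow> D \<noteq> E \<and> dot D E \<ge> 1 \<longleftrightarrow> (f D, f E) \<in> parcs (?U ss)"
    using A unfolding of_type_iff by blast
  obtain g where g: "bij_betw g (set_mset B) (pverts (?U ts))"
    and ga: "\<And>D E. D \<in># B \<Longrightarrow> E \<in># B \<Longrightarrow> D \<noteq> E \<and> dot D E \<ge> 1 \<longleftrightarrow> (g D, g E) \<in> parcs (?U ts)"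
    using B unfolding of_type_iff by blast
  let ?s = "\<lambda>x :: nat \<times> nat. (fst x + length ss, snd x)"
  define h where "h D = (if D \<in># A then f D else ?s (g D))" for D
  have hA: "h D = f D" if "D \<in># A" for D using that by (simp add: h_def)
  have hB: "h D = ?s (g D)" if "D \<in># B" for D using that disj by (auto simp: h_def)
  have V: "pverts (?U (ss @ ts)) = pverts (?U ss) \<union> ?s ` pverts (?U ts)" (is "?l = ?r")
  proof
    show "?l \<subseteq> ?r"
    proof
      fix x assume x: "x \<in> ?l"
      show "x \<in> ?r"
      proof (cases "fst x < length ss")
        case True with x show ?thesis by (auto simp: disjoint_union_def nth_append)
      next
        case False
        with x have "(fst x - length ss, snd x) \<in> pverts (?U ts)"
          by (auto simp: disjoint_union_def nth_append)
        then show ?thesis using False by (intro UnI2 image_eqI[of _ _ "(fst x - length ss, snd x)"]) auto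
      qed
    qed
    show "?r \<subseteq> ?l" by (auto simp: disjoint_union_def nth_append)
  qed
  have lt: "fst x < length ss" if "x \<in> pverts (?U ss)" for x
    using that by (auto simp: disjoint_union_def)
  have fV: "fst (f D) < length ss" if "D \<in># A" for D
    using f that by (auto simp: bij_betw_def intro!: lt)
  have "bij_betw h (set_mset A) (pverts (?U ss))"
    using f hA by (simp cong: bij_betw_cong)
  moreover have "bij_betw ?s (pverts (?U ts)) (?s ` pverts (?U ts))"
    by (rule inj_on_imp_bij_betw) (auto simp: inj_on_def prod_eq_iff)
  from bij_betw_trans[OF g this] have "bij_betw h (set_mset B) (?s ` pverts (?U ts))"
    using hB by (simp cong: bij_betw_cong)
  moreover have "pverts (?U ss) \<inter> ?s ` pverts (?U ts) = {}"
    using lt by fastforce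
  ultimately have "bij_betw h (set_mset (A + B)) (pverts (?U (ss @ ts)))"
    unfolding V set_mset_union by (rule bij_betw_combine)
  moreover have "D \<noteq> E \<and> dot D E \<ge> 1 \<longleftrightarrow> (h D, h E) \<in> parcs (?U (ss @ ts))"
    if D: "D \<in># A + B" and E: "E \<in># A + B" for D E
  proof -
    consider "D \<in># A" "E \<in># A" | "D \<in># A" "E \<in># B" | "D \<in># B" "E \<in># A" | "D \<in># B" "E \<in># B"
      using D E by (meson union_iff)
    then show ?thesis
    proof cases
      case 1
      then show ?thesis
        using fa[OF 1] fV[of D] hA by (auto simp: disjoint_union_def nth_append case_prod_beta)
    next
      case 2
      then show ?thesis
        using orth[OF 2] fV[of D] hA hB by (auto simp: disjoint_union_def case_prod_beta)
    next
      case 3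
      then show ?thesis
        using orth[OF 3(2,1)] fV[of E] hA hB by (auto simp: disjoint_union_def case_prod_beta)
    next
      case 4
      then show ?thesis
        using ga[OF 4] hB by (auto simp: disjoint_union_def nth_append case_prod_beta)
    qed
  qed
  ultimately show ?thesis
    using A B unfolding of_type_iff[of dot "A + B"] by (auto simp: of_type_def)
qed

text \<open>The dual graph sees a divisor only through its support. Hence a divisor known only by
  its support can be replaced by a sum of explicit pieces.\<close>

lemma of_type_cong:
  assumes "set_mset A = set_mset B"
  shows "of_type dot A ts \<longleftrightarrow> of_type dot B ts"
  using assms by (simp add: of_type_def dual_graph_def)

section \<open>Reduced divisors and components\<close>

lemma reduced_subset: "reduced R \<Longrightarrow> A \<subseteq># R \<Longrightarrow> reduced A"
  unfolding reduced_def by (meson mset_subset_eq_count order_trans)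

text \<open>Multiplicities are 0 or 1, so they can be read off from the support; this turns
  computations of supports into identities of divisors.\<close>

lemma reduced_eqI:
  assumes "reduced A" "reduced B" "set_mset A = set_mset B"
  shows "A = B"
proof (rule multiset_eqI)
  fix D
  have "count A D \<le> 1" "count B D \<le> 1" "0 < count A D \<longleftrightarrow> 0 < count B D"
    using assms by (auto simp: reduced_def set_eq_iff count_greater_zero_iff)
  then show "count A D = count B D" by linarith
qed

lemma reduced_add_mset: "reduced (add_mset D A) \<longleftrightarrow> D \<notin># A \<and> reduced A"
proof
  assume *: "reduced (add_mset D A)"
  then have "reduced A" by (rule reduced_subset) simp
  moreover from * have "count (add_mset D A) D \<le> 1" unfolding reduced_def by blast
  ultimately show "D \<notin># A \<and> reduced A" by (simp add: not_in_iff)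
qed (auto simp: reduced_def not_in_iff)

text \<open>By symmetry of the graph, strong connectedness to \<open>D\<close> is the same as
  reachability from \<open>D\<close>. Then \<open>reach\<close> puts \<open>S\<close> inside the
  component, and \<open>closed\<close> gives the reverse inclusion by induction along a
  walk.\<close>

lemma component_of_eqI:
  assumes sym: "\<And>D E. dot D E = dot E D"
    and "D \<in> S"
    and reach: "\<And>E. E \<in> S \<Longrightarrow> D \<rightarrow>\<^sup>*\<^bsub>with_proj (dual_graph dot R)\<^esub> E"
    and closed: "\<And>A B. A \<in> S \<Longrightarrow> B \<in># R \<Longrightarrow> A \<noteq> B \<Longrightarrow> dot A B \<ge> 1 \<Longrightarrow> B \<in> S"
  shows "component_of dot R D = filter_mset (\<lambda>E. E \<in> S) R"
proof -
  let ?G = "with_proj (dual_graph dot R)"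
  interpret pair_wf_digraph "dual_graph dot R" by (rule pair_wf_digraph_dual_graph)
  have "symmetric ?G"
    unfolding symmetric_def using sym by (intro symI) (auto simp: dual_graph_def)
  note sym_reach = symmetric_reachable[OF this]
  have "E \<in> S" if "D \<rightarrow>\<^sup>*\<^bsub>?G\<^esub> E" for E
    using that
  proof (induction rule: reachable_induct)
    case base
    show ?case by fact
  next
    case (step x y)
    then show ?case by (intro closed[of x y]) (simp_all add: dual_graph_def)
  qed
  then have "pre_digraph.scc_of ?G D = S"
    unfolding scc_of_def using reach sym_reach by blast
  then show ?thesis by (simp add: component_of_def)
qed

section \<open>Subdivisors of a fiber of type \<open>I\<^sub>n\<^sup>*\<close>\<close>

locale i_star =
  fixes dot :: "'c \<Rightarrow> 'c \<Rightarrow> int"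
    and n :: nat
    and C :: "nat \<Rightarrow> 'c"
    and C0' C0'' Cn' Cn'' :: 'c
    and F :: "'c multiset"
  assumes fiber: "I_star_fiber dot n C C0' C0'' Cn' Cn'' F"
begin

text \<open>The arc relation of any dual graph with membership in the divisor stripped off, so that
  one set of simp rules serves all subdivisors of \<open>F\<close>.\<close>

definition adj :: "'c \<Rightarrow> 'c \<Rightarrow> bool" where
  "adj D E \<longleftrightarrow> D \<noteq> E \<and> dot D E \<ge> 1"

lemma dot_commute: "dot D E = dot E D"
  using fiber by (simp add: I_star_fiber_def)

lemma n_pos: "0 < n"
  using fiber by (simp add: I_star_fiber_def)

lemma distinct_curves: "distinct ([C0', C0''] @ map C [0..<Suc n] @ [Cn', Cn''])"
  using fiber unfolding I_star_fiber_def by blast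

lemma leaves_distinct [simp]:
  "C0' \<noteq> C0''" "C0' \<noteq> Cn'" "C0' \<noteq> Cn''" "C0'' \<noteq> Cn'" "C0'' \<noteq> Cn''" "Cn' \<noteq> Cn''"
  "C0'' \<noteq> C0'" "Cn' \<noteq> C0'" "Cn'' \<noteq> C0'" "Cn' \<noteq> C0''" "Cn'' \<noteq> C0''" "Cn'' \<noteq> Cn'"
  using distinct_curves by auto

lemma inj_on_C: "inj_on C {..n}"
proof -
  have "{0..<Suc n} = {..n}" by auto
  then show ?thesis
    using distinct_curves by (simp only: distinct_append distinct_map set_upt)
qed

lemma C_eq_iff [simp]: "i \<le> n \<Longrightarrow> j \<le> n \<Longrightarrow> C i = C j \<longleftrightarrow> i = j"
  using inj_on_C by (auto dest: inj_onD)

lemma C_neq_leaf [simp]: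
  assumes "i \<le> n"
  shows "C i \<noteq> C0'" "C i \<noteq> C0''" "C i \<noteq> Cn'" "C i \<noteq> Cn''"
    "C0' \<noteq> C i" "C0'' \<noteq> C i" "Cn' \<noteq> C i" "Cn'' \<noteq> C i"
proof -
  have "C i \<in> C ` {0..<Suc n}" using assms by auto
  then show "C i \<noteq> C0'" "C i \<noteq> C0''" "C i \<noteq> Cn'" "C i \<noteq> Cn''"
    "C0' \<noteq> C i" "C0'' \<noteq> C i" "Cn' \<noteq> C i" "Cn'' \<noteq> C i"
    using distinct_curves by auto
qed

lemma set_mset_chain: "set_mset (chain C a l) = C ` {a..<a + l}"
  by (simp add: chain_def)

lemma set_mset_F: "set_mset F = {C0', C0'', Cn', Cn''} \<union> C ` {..n}"
proof -
  have F: "F = {#C0', C0''#} + repeat_mset 2 (chain C 0 (Suc n)) + {#Cn', Cn''#}"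
    using fiber unfolding I_star_fiber_def by blast
  have "{0..<Suc n} = {..n}" by auto
  then have "set_mset (repeat_mset 2 (chain C 0 (Suc n))) = C ` {..n}"
    by (simp add: set_mset_chain numeral_2_eq_2)
  then show ?thesis unfolding F by auto
qed

lemma F_cases:
  assumes "D \<in># F"
  obtains i where "i \<le> n" "D = C i" | "D = C0'" | "D = C0''" | "D = Cn'" | "D = Cn''"
  using assms unfolding set_mset_F by auto

lemma adj_iff:
  assumes "D \<in># F" "E \<in># F"
  shows "adj D E \<longleftrightarrow> (D, E) \<in> {(C i, C (Suc i)) | i. i < n} \<union> {(C0', C 0), (C0'', C 0), (C n, Cn'), (C n, Cn'')}
    \<or> (E, D) \<in> {(C i, C (Suc i)) | i. i < n} \<union> {(C0', C 0), (C0'', C 0), (C n, Cn'), (C n, Cn'')}"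
proof -
  have "dual_graph dot F = undirected (set_mset F)
      ({(C i, C (Suc i)) | i. i < n} \<union> {(C0', C 0), (C0'', C 0), (C n, Cn'), (C n, Cn'')})"
    using fiber unfolding I_star_fiber_def by blast
  from arg_cong[OF this, of "\<lambda>G. (D, E) \<in> parcs G"] show ?thesis
    using assms by (simp add: adj_def dual_graph_def undirected_def)
qed

lemma adj_C_C [simp]: "i \<le> n \<Longrightarrow> j \<le> n \<Longrightarrow> adj (C i) (C j) \<longleftrightarrow> j = Suc i \<or> i = Suc j"
  by (subst adj_iff) (auto simp: set_mset_F)

lemma adj_left_leaf [simp]:
  assumes "i \<le> n"
  shows "adj C0' (C i) \<longleftrightarrow> i = 0" "adj C0'' (C i) \<longleftrightarrow> i = 0"
    "adj (C i) C0' \<longleftrightarrow> i = 0" "adj (C i) C0'' \<longleftrightarrow> i = 0"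
  using assms by (subst adj_iff; auto simp: set_mset_F)+

lemma adj_right_leaf [simp]:
  assumes "i \<le> n"
  shows "adj Cn' (C i) \<longleftrightarrow> i = n" "adj Cn'' (C i) \<longleftrightarrow> i = n"
    "adj (C i) Cn' \<longleftrightarrow> i = n" "adj (C i) Cn'' \<longleftrightarrow> i = n"
  using assms by (subst adj_iff; auto simp: set_mset_F)+

lemma not_adj_leaf_leaf [simp]:
  assumes "D \<in> {C0', C0'', Cn', Cn''}" "E \<in> {C0', C0'', Cn', Cn''}"
  shows "\<not> adj D E"
  using assms by (subst adj_iff) (auto simp: set_mset_F)

section \<open>Dynkin types of the pieces of a subdivisor\<close>

lemma of_type_singleI:
  assumes "valid_dynkin t"
    and "bij_betw f (pverts (dynkin_graph t)) (set_mset R)"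
    and "\<And>i j. i \<in> pverts (dynkin_graph t) \<Longrightarrow> j \<in> pverts (dynkin_graph t) \<Longrightarrow>
      (i, j) \<in> parcs (dynkin_graph t) \<longleftrightarrow> adj (f i) (f j)"
  shows "of_type dot R [t]"
  using assms by (intro of_type_single) (auto simp: adj_def)

lemma of_type_appendI:
  assumes "of_type dot A ss" "of_type dot B ts"
    and disj: "set_mset A \<inter> set_mset B = {}"
    and orth: "\<And>D E. D \<in># A \<Longrightarrow> E \<in># B \<Longrightarrow> \<not> adj D E"
  shows "of_type dot (A + B) (ss @ ts)"
proof (rule of_type_append)
  fix D E assume "D \<in># A" "E \<in># B"
  with disj have "D \<noteq> E" by auto
  with orth[OF \<open>D \<in># A\<close> \<open>E \<in># B\<close>] show "dot D E < 1 \<and> dot E D < 1"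
    by (simp add: adj_def dot_commute[of E D])
qed fact+

lemma of_type_chain:
  assumes "l \<ge> 1" "a + l \<le> Suc n"
  shows "of_type dot (chain C a l) [DynA l]"
proof (rule of_type_singleI)
  have "{a..<a + l} = (\<lambda>i. a + i) ` {..<l}"
    by (simp add: lessThan_atLeast0 add.commute)
  then show "bij_betw (\<lambda>i. C (a + i)) (pverts (dynkin_graph (DynA l))) (set_mset (chain C a l))"
    using assms by (simp add: undirected_def set_mset_chain bij_betw_def inj_on_def image_image)
qed (use assms in \<open>auto simp: undirected_def\<close>)

lemma of_type_leaf_chain:
  assumes "L \<in> {C0', C0''}" "p \<le> n"
  shows "of_type dot ({#L#} + chain C 0 p) [DynA (p + 1)]"
proof (rule of_type_singleI)
  \<comment> \<open>The leaf becomes the first vertex of the path, in front of \<open>C 0\<close>,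
    and the chain is shifted by one.\<close>
  let ?f = "\<lambda>i. if i = 0 then L else C (i - 1)"
  have "?f ` {..<Suc p} = insert L (C ` {..<p})"
    unfolding lessThan_Suc_eq_insert_0 by (simp only: image_insert image_image) simp
  then show "bij_betw ?f (pverts (dynkin_graph (DynA (p + 1)))) (set_mset ({#L#} + chain C 0 p))"
    using assms by (auto simp: undirected_def set_mset_chain bij_betw_def inj_on_def lessThan_atLeast0)
qed (use assms in \<open>auto simp: undirected_def\<close>)

text \<open>The path has \<open>C 0\<close> in the middle. The pattern \<open>DynD (p + 2)\<close>
  at \<open>p = 1\<close> would give \<open>DynD 3\<close>, which is not a valid symbol.\<close>

lemma of_type_A3_special: "of_type dot {#C0', C 0, C0''#} [DynA 3]"
  by (intro of_type_singleI[where f = "\<lambda>i. if i = 0 then C0' else if i = 1 then C 0 else C0''"])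
    (auto simp: undirected_def bij_betw_def inj_on_def image_iff numeral_3_eq_3 less_Suc_eq)

text \<open>The path of the type D diagram is read as \<open>C (p - 1), \<dots>, C 0, C0'\<close>; the extra vertex
  \<open>C0''\<close> is attached to \<open>C 0\<close>, which is the last but one.\<close>

lemma of_type_leaves_chain:
  assumes "p \<ge> 2" "p \<le> n"
  shows "of_type dot ({#C0', C0''#} + chain C 0 p) [DynD (p + 2)]"
proof (rule of_type_singleI)
  let ?f = "\<lambda>i. if i < p then C (p - 1 - i) else if i = p then C0' else C0''"
  show "valid_dynkin (DynD (p + 2))" using assms by simp
  have "{..<p + 2} = {..<p} \<union> {p, Suc p}" by auto
  then have "?f ` {..<p + 2} = (\<lambda>i. C (p - 1 - i)) ` {..<p} \<union> {C0', C0''}"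
    by (simp only: image_Un) (auto simp: image_def)
  also have "(\<lambda>i. C (p - 1 - i)) ` {..<p} = C ` {0..<p}"
  proof (intro equalityI subsetI)
    fix D assume "D \<in> C ` {0..<p}"
    then obtain i where "D = C i" "i < p" by auto
    then show "D \<in> (\<lambda>i. C (p - 1 - i)) ` {..<p}"
      by (intro image_eqI[of _ _ "p - 1 - i"]) auto
  qed auto
  finally have "?f ` {..<p + 2} = C ` {0..<p} \<union> {C0', C0''}" .
  then show "bij_betw ?f (pverts (dynkin_graph (DynD (p + 2)))) (set_mset ({#C0', C0''#} + chain C 0 p))"
    using assms by (auto simp: undirected_def set_mset_chain bij_betw_def inj_on_def)
  show "(i, j) \<in> parcs (dynkin_graph (DynD (p + 2))) \<longleftrightarrow> adj (?f i) (?f j)"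
    if "i \<in> pverts (dynkin_graph (DynD (p + 2)))" "j \<in> pverts (dynkin_graph (DynD (p + 2)))" for i j
    using assms that by (auto simp: undirected_def)
qed

lemma reduced_chain:
  assumes "a + l \<le> Suc n"
  shows "reduced (chain C a l)"
proof -
  have "inj_on C {a..<a + l}"
    using assms by (auto intro: inj_on_subset[OF inj_on_C])
  then have "distinct (map C [a..<a + l])"
    by (simp add: distinct_map)
  then show ?thesis
    unfolding chain_def reduced_def mset_map[symmetric] distinct_count_atmost_1 by simp
qed

lemma of_type_leaf:
  assumes "D \<in> {C0', C0'', Cn', Cn''}"
  shows "of_type dot {#D#} [DynA 1]"
  using assms by (intro of_type_singleI[where f = "\<lambda>_. D"])
    (auto simp: undirected_def bij_betw_def inj_on_def)

text \<open>The two right leaves do not meet each other, so together they contribute two separate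
  copies of \<open>DynA 1\<close>.\<close>

lemma of_type_right_leaves:
  assumes "B \<in> {{#}, {#Cn'#}, {#Cn''#}, {#Cn', Cn''#}}"
  obtains ts where "of_type dot B ts"
proof -
  consider "B = {#}" | "B = {#Cn'#}" | "B = {#Cn''#}" | "B = {#Cn'#} + {#Cn''#}"
    using assms by auto
  then show ?thesis
  proof cases
    case 1
    then show ?thesis by (intro that[of "[]"]) (simp add: of_type_Nil)
  next
    case 4
    have "of_type dot ({#Cn'#} + {#Cn''#}) ([DynA 1] @ [DynA 1])"
      by (intro of_type_appendI of_type_leaf) auto
    with 4 that show ?thesis by simp
  qed (use that of_type_leaf[of Cn'] of_type_leaf[of Cn''] in simp_all)
qed

text \<open>Each subchain uses up one further vertex of \<open>C a, \<dots>, C b\<close>, the one following it;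
  this is where the bound comes from.\<close>

lemma of_type_central:
  assumes "set_mset R = C ` S" "S \<subseteq> {a..<b}" "b \<le> Suc n"
  shows "\<exists>ls. (\<forall>l \<in> set ls. l \<ge> 1) \<and> of_type dot R (map DynA ls) \<and>
    sum_list ls + length ls \<le> b + 1 - a"
  using assms
proof (induction "b - a" arbitrary: a R S rule: less_induct)
  case less
  show ?case
  proof (cases "S = {}")
    case True
    with less.prems have "R = {#}" by simp
    then show ?thesis by (intro exI[of _ "[]"]) (simp add: of_type_Nil)
  next
    case False
    define a' where "a' = Min S"
    have fin: "finite S" using less.prems(2) by (rule finite_subset) simp
    have a': "a' \<in> S" "\<And>i. i \<in> S \<Longrightarrow> a' \<le> i"
      using False fin by (auto simp: a'_def)
    \<comment> \<open>The first gap after the first used index \<open>a'\<close>; it exists and is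
      at most \<open>b\<close>, because \<open>b\<close> lies outside \<open>S\<close>. The block
      from \<open>a'\<close> to \<open>p - 1\<close> is split off, and the induction continues from
      \<open>Suc p\<close>.\<close>
    define p where "p = (LEAST i. a' \<le> i \<and> i \<notin> S)"
    have "b \<notin> S" "a' < b" "a \<le> a'" using less.prems(2) a'(1) by auto
    then have p: "a' \<le> p" "p \<notin> S" and "p \<le> b"
      using LeastI[of "\<lambda>i. a' \<le> i \<and> i \<notin> S" b] Least_le[of "\<lambda>i. a' \<le> i \<and> i \<notin> S" b]
      by (auto simp: p_def)
    have p_min: "i \<in> S" if "a' \<le> i" "i < p" for i
      using that not_less_Least[of i "\<lambda>i. a' \<le> i \<and> i \<notin> S"] by (auto simp: p_def)
    from p a'(1) have "a' < p" by (cases "a' = p") auto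
    define T where "T = S \<inter> {Suc p..<b}"
    have S: "S = {a'..<p} \<union> T"
    proof (intro equalityI subsetI)
      fix i assume "i \<in> S"
      moreover from this have "a' \<le> i" "i \<noteq> p" "i < b" using a' p less.prems(2) by auto
      ultimately show "i \<in> {a'..<p} \<union> T" by (auto simp: T_def)
    qed (auto simp: T_def p_min)
    let ?T = "image_mset C (mset_set T)"
    have T: "set_mset ?T = C ` T" using fin by (simp add: T_def)
    have "T \<subseteq> {Suc p..<b}" by (auto simp: T_def)
    have "b - Suc p < b - a" using \<open>a \<le> a'\<close> \<open>a' < p\<close> \<open>p \<le> b\<close> by linarith
    from less.hyps[OF this T \<open>T \<subseteq> _\<close> less.prems(3)] obtain ls where
      ls: "\<forall>l \<in> set ls. l \<ge> 1" "of_type dot ?T (map DynA ls)" "sum_list ls + length ls \<le> b + 1 - Suc p"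
      by blast
    have "of_type dot (chain C a' (p - a') + ?T) ([DynA (p - a')] @ map DynA ls)"
    proof (rule of_type_appendI)
      show "of_type dot (chain C a' (p - a')) [DynA (p - a')]"
        using \<open>a' < p\<close> \<open>p \<le> b\<close> less.prems(3) by (intro of_type_chain) auto
      show "set_mset (chain C a' (p - a')) \<inter> set_mset ?T = {}"
        using \<open>a' < p\<close> less.prems(3) unfolding T by (auto simp: set_mset_chain T_def)
      show "\<not> adj D E" if "D \<in># chain C a' (p - a')" "E \<in># ?T" for D E
      proof -
        from that(1) obtain i where "D = C i" "i < p" using \<open>a' < p\<close> by (auto simp: set_mset_chain)
        moreover from that(2) obtain j where "E = C j" "p < j" "j < b"
          unfolding T by (auto simp: T_def)
        ultimately show ?thesis using less.prems(3) by simp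
      qed
    qed fact
    moreover have "set_mset R = set_mset (chain C a' (p - a') + ?T)"
      using \<open>a' < p\<close> by (simp only: less.prems(1) S T set_mset_union set_mset_chain image_Un) simp
    ultimately have "of_type dot R (map DynA ((p - a') # ls))"
      using of_type_cong[of R "chain C a' (p - a') + ?T"] by simp
    \<comment> \<open>The new block adds \<open>p - a' + 1\<close> to the bound \<open>b - p\<close>
      for the rest, which gives \<open>b + 1 - a'\<close>, at most \<open>b + 1 - a\<close>.\<close>
    then show ?thesis
      using ls \<open>a \<le> a'\<close> \<open>a' < p\<close> \<open>p \<le> b\<close>
      by (intro exI[of _ "(p - a') # ls"]) auto
  qed
qed

section \<open>The component of \<open>C 0\<close> and its four shapes\<close>

lemma central_count_eqI:
  assumes "set_mset R \<inter> C ` {0..n} = C ` {..<p}" "p \<le> n"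
  shows "central_count C n R = p"
  using assms by (simp add: central_count_def card_image inj_on_subset[OF inj_on_C] subset_eq)

lemma component_of_C0:
  assumes R: "R \<subseteq># F" and p: "1 \<le> p" "p \<le> n" "C p \<notin># R" "\<And>i. i < p \<Longrightarrow> C i \<in># R"
  shows "component_of dot R (C 0) =
    filter_mset (\<lambda>D. D \<in> (set_mset R \<inter> {C0', C0''}) \<union> C ` {..<p}) R"
proof (rule component_of_eqI)
  let ?G = "with_proj (dual_graph dot R)"
  interpret pair_wf_digraph "dual_graph dot R" by (rule pair_wf_digraph_dual_graph)
  have arc: "(D, E) \<in> parcs (dual_graph dot R)" if "D \<in># R" "E \<in># R" "adj D E" for D E
    using that by (auto simp: dual_graph_def adj_def)
  have C0: "C 0 \<rightarrow>\<^sup>*\<^bsub>?G\<^esub> C 0"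
    using p by (intro reachable_refl) (simp add: dual_graph_def)
  have reach: "C 0 \<rightarrow>\<^sup>*\<^bsub>?G\<^esub> C i" if "i < p" for i
    using that
  proof (induction i)
    case (Suc i)
    then have "(C i, C (Suc i)) \<in> parcs (dual_graph dot R)"
      using p by (intro arc) auto
    with Suc show ?case by (auto intro: reachable_adj_trans)
  qed (rule C0)
  show "C 0 \<rightarrow>\<^sup>*\<^bsub>?G\<^esub> E" if "E \<in> (set_mset R \<inter> {C0', C0''}) \<union> C ` {..<p}" for E
  proof (cases "E \<in> C ` {..<p}")
    case False
    with that p have "(C 0, E) \<in> parcs (dual_graph dot R)"
      by (intro arc) auto
    with C0 show ?thesis by (auto intro: reachable_adj_trans)
  qed (use reach in auto)
  show "E \<in> (set_mset R \<inter> {C0', C0''}) \<union> C ` {..<p}"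
    if D: "D \<in> (set_mset R \<inter> {C0', C0''}) \<union> C ` {..<p}" and E: "E \<in># R" and "D \<noteq> E" "dot D E \<ge> 1" for D E
  proof -
    have adj: "adj D E" using that by (simp add: adj_def)
    from E R have "E \<in># F" by (rule mset_subset_eqD[rotated])
    then show ?thesis
    proof (cases rule: F_cases)
      case (1 j)
      \<comment> \<open>From \<open>C i\<close> with \<open>i < p\<close> a step along the chain
        reaches at most index \<open>p\<close>, and \<open>C p\<close> is missing; from a left leaf
        it reaches only \<open>C 0\<close>.\<close>
      have "j < p"
      proof (cases "D \<in> C ` {..<p}")
        case True
        then obtain i where "D = C i" "i < p" by auto
        with adj 1 p(2) have "j = Suc i \<or> i = Suc j" by simp
        moreover have "j \<noteq> p" using 1 E p(3) by auto
        ultimately show ?thesis using \<open>i < p\<close> by auto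
      next
        case False
        with D adj 1 p(1) show ?thesis by auto
      qed
      with 1 show ?thesis by auto
    \<comment> \<open>Left leaves of \<open>R\<close> lie in the set by construction. A right leaf
      meets only \<open>C n\<close>, whose index is not below \<open>p\<close>.\<close>
    qed (use D E adj p(2) in auto)
  qed
qed (use p dot_commute in auto)

text \<open>The four shapes share the index \<open>p\<close>, the number of central curves. The
  third is the divisor of the fourth at \<open>p = 1\<close>, kept apart because its type is A
  instead of D.\<close>

definition left_part :: "nat \<Rightarrow> 'c multiset \<Rightarrow> bool" where
  "left_part p \<Gamma> \<longleftrightarrow> \<Gamma> = chain C 0 p \<or> (\<exists>L \<in> {C0', C0''}. \<Gamma> = {#L#} + chain C 0 p) \<or>
     p = 1 \<and> \<Gamma> = {#C0', C 0, C0''#} \<or> 2 \<le> p \<and> \<Gamma> = {#C0', C0''#} + chain C 0 p"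

lemma set_mset_left_part:
  assumes "left_part p \<Gamma>" "1 \<le> p"
  shows "C ` {..<p} \<subseteq> set_mset \<Gamma>" "set_mset \<Gamma> \<subseteq> {C0', C0''} \<union> C ` {..<p}"
  using assms by (auto simp: left_part_def set_mset_chain lessThan_atLeast0)

lemma central_count_left_part:
  assumes "left_part p \<Gamma>" "1 \<le> p" "p \<le> n"
  shows "central_count C n \<Gamma> = p"
  using set_mset_left_part[OF assms(1,2)] assms(3) by (intro central_count_eqI) auto

lemma left_part_cases:
  assumes "left_part p \<Gamma>" "1 \<le> p" "p \<le> n"
  obtains (chain) "\<Gamma> = chain C 0 p" "of_type dot \<Gamma> [DynA p]"
  | (leaf) L where "L \<in> {C0', C0''}" "\<Gamma> = {#L#} + chain C 0 p" "of_type dot \<Gamma> [DynA (p + 1)]"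
  | (A3) "p = 1" "\<Gamma> = {#C0', C 0, C0''#}" "of_type dot \<Gamma> [DynA 3]"
  | (D) "2 \<le> p" "\<Gamma> = {#C0', C0''#} + chain C 0 p" "of_type dot \<Gamma> [DynD (p + 2)]"
proof -
  consider "\<Gamma> = chain C 0 p" | L where "L \<in> {C0', C0''}" "\<Gamma> = {#L#} + chain C 0 p"
    | "p = 1" "\<Gamma> = {#C0', C 0, C0''#}" | "2 \<le> p" "\<Gamma> = {#C0', C0''#} + chain C 0 p"
    using assms(1) unfolding left_part_def by blast
  then show ?thesis
  proof cases
    case 1
    with of_type_chain[of p 0] assms(2,3) show ?thesis by (intro chain) auto
  next
    case (2 L)
    with of_type_leaf_chain[of L p] assms(3) show ?thesis by (intro leaf) auto
  next
    case 3
    with of_type_A3_special show ?thesis by (intro A3) auto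
  next
    case 4
    with of_type_leaves_chain[of p] assms(3) show ?thesis by (intro D) auto
  qed
qed

text \<open>The inclusions leave only the choice of left leaves open, and reducedness then
  determines the divisor; both leaves together are split according to whether
  \<open>p = 1\<close>.\<close>

lemma left_partI:
  assumes "reduced \<Gamma>" "1 \<le> p" "p \<le> n"
    and "C ` {..<p} \<subseteq> set_mset \<Gamma>" "set_mset \<Gamma> \<subseteq> {C0', C0''} \<union> C ` {..<p}"
  shows "left_part p \<Gamma>"
proof -
  have chain: "set_mset (chain C 0 p) = C ` {..<p}" "reduced (chain C 0 p)"
    using assms(3) by (auto simp: set_mset_chain lessThan_atLeast0 intro: reduced_chain)
  have nin: "C0' \<notin># chain C 0 p" "C0'' \<notin># chain C 0 p"
    using assms(3) by (auto simp: chain)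
  have set_eq: "set_mset \<Gamma> = (set_mset \<Gamma> \<inter> {C0', C0''}) \<union> C ` {..<p}"
    using assms(4,5) by auto
  note eqI = reduced_eqI[OF assms(1)]
  consider "C0' \<notin># \<Gamma>" "C0'' \<notin># \<Gamma>" | "C0' \<in># \<Gamma>" "C0'' \<notin># \<Gamma>" | "C0' \<notin># \<Gamma>" "C0'' \<in># \<Gamma>"
    | "C0' \<in># \<Gamma>" "C0'' \<in># \<Gamma>" "p = 1" | "C0' \<in># \<Gamma>" "C0'' \<in># \<Gamma>" "2 \<le> p"
    using assms(2) by (cases "p = 1") auto
  then show ?thesis
  proof cases
    case 1
    then have "\<Gamma> = chain C 0 p"
      by (intro eqI) (use set_eq chain in auto)
    then show ?thesis by (simp add: left_part_def)
  next
    case 2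
    then have "\<Gamma> = {#C0'#} + chain C 0 p"
      by (intro eqI) (use set_eq chain nin in \<open>auto simp: reduced_add_mset\<close>)
    then show ?thesis by (simp add: left_part_def)
  next
    case 3
    then have "\<Gamma> = {#C0''#} + chain C 0 p"
      by (intro eqI) (use set_eq chain nin in \<open>auto simp: reduced_add_mset\<close>)
    then show ?thesis by (simp add: left_part_def)
  next
    case 4
    then have "\<Gamma> = {#C0', C 0, C0''#}"
      by (intro eqI) (use set_eq in \<open>auto simp: reduced_add_mset reduced_def[of "{#}"]\<close>)
    then show ?thesis using 4 by (simp add: left_part_def)
  next
    case 5
    then have "\<Gamma> = {#C0', C0''#} + chain C 0 p"
      by (intro eqI) (use set_eq chain nin in \<open>auto simp: reduced_add_mset\<close>)
    then show ?thesis using 5 by (simp add: left_part_def)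
  qed
qed

lemma ADER_structure:
  assumes R: "R \<subseteq># F" "reduced R" "C 0 \<in># R" "C n \<notin># R"
    and \<Gamma>: "\<Gamma> = component_of dot R (C 0)"
    and RM: "R\<^sub>M = filter_mset (\<lambda>D. D \<in> C ` {0..n}) (R - \<Gamma>)"
    and BR: "B\<^sub>R = filter_mset (\<lambda>D. D \<in> {Cn', Cn''}) R"
  obtains p where "1 \<le> p" "p \<le> n" "left_part p \<Gamma>" "R = \<Gamma> + R\<^sub>M + B\<^sub>R"
    "set_mset R\<^sub>M \<subseteq> C ` {p + 1..<n}" "B\<^sub>R \<in> {{#}, {#Cn'#}, {#Cn''#}, {#Cn', Cn''#}}"
proof -
  \<comment> \<open>The missing curve \<open>C n\<close> shows that such an index exists and that
    \<open>p \<le> n\<close>; the presence of \<open>C 0\<close> makes it positive.\<close>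
  define p where "p = (LEAST i. C i \<notin># R)"
  have p: "C p \<notin># R" "p \<le> n"
    using R(4) unfolding p_def by (rule LeastI, rule Least_le)
  have p_min: "C i \<in># R" if "i < p" for i
    using that not_less_Least[of i "\<lambda>i. C i \<notin># R"] by (auto simp: p_def)
  have "1 \<le> p" using p(1) R(3) by (cases p) auto
  let ?S = "(set_mset R \<inter> {C0', C0''}) \<union> C ` {..<p}"
  have \<Gamma>': "\<Gamma> = filter_mset (\<lambda>D. D \<in> ?S) R"
    using component_of_C0[OF R(1) \<open>1 \<le> p\<close> p(2,1) p_min] by (simp only: \<Gamma>)
  then have "set_mset \<Gamma> = ?S" using p_min by auto
  moreover have "reduced \<Gamma>" using R(2) by (rule reduced_subset) (simp add: \<Gamma>')
  ultimately have left: "left_part p \<Gamma>"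
    using \<open>1 \<le> p\<close> p(2) by (intro left_partI) auto
  \<comment> \<open>The component takes each curve with its full multiplicity or not at all, so
    \<open>R - \<Gamma>\<close> is exactly the part of \<open>R\<close> outside \<open>?S\<close>.
    The decomposition can then be checked curve by curve.\<close>
  have cnt: "count \<Gamma> D = (if D \<in> ?S then count R D else 0)" for D
    unfolding \<Gamma>' by simp
  have "R = \<Gamma> + R\<^sub>M + B\<^sub>R"
  proof (rule multiset_eqI)
    fix D
    show "count R D = count (\<Gamma> + R\<^sub>M + B\<^sub>R) D"
    proof (cases "D \<in># R")
      case True
      with R(1) have "D \<in># F" by (rule mset_subset_eqD)
      then show ?thesis
        using True p(2) by (cases rule: F_cases) (auto simp: RM BR cnt)
    next
      case False
      then have "count R D = 0" by (simp add: not_in_iff)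
      then show ?thesis by (auto simp: RM BR cnt)
    qed
  qed
  moreover have "set_mset R\<^sub>M \<subseteq> C ` {p + 1..<n}"
  proof
    fix D assume "D \<in># R\<^sub>M"
    then obtain i where i: "D = C i" "i \<le> n" and "D \<in># R - \<Gamma>"
      by (auto simp: RM simp del: filter_diff_mset)
    then have "D \<in># R" "D \<notin> ?S"
      using cnt[of D] by (auto simp: in_diff_count dest: in_diffD split: if_splits)
    with i p(1) R(4) have "i \<noteq> p" "\<not> i < p" "i \<noteq> n" by auto
    with i show "D \<in> C ` {p + 1..<n}" by auto
  qed
  moreover have "B\<^sub>R \<in> {{#}, {#Cn'#}, {#Cn''#}, {#Cn', Cn''#}}"
  proof -
    have red: "reduced B\<^sub>R" using R(2) by (rule reduced_subset) (simp add: BR)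
    have "set_mset B\<^sub>R \<subseteq> {Cn', Cn''}" by (auto simp: BR)
    then have "set_mset B\<^sub>R \<in> {{}, {Cn'}, {Cn''}, {Cn', Cn''}}" by auto
    then obtain B where "B \<in> {{#}, {#Cn'#}, {#Cn''#}, {#Cn', Cn''#}}" "set_mset B\<^sub>R = set_mset B"
      by force
    moreover from this(1) have "reduced B" by (auto simp: reduced_add_mset reduced_def[of "{#}"])
    ultimately show ?thesis using reduced_eqI[OF red] by metis
  qed
  ultimately show ?thesis using that \<open>1 \<le> p\<close> p(2) left by blast
qed

lemma ADER_left_part:
  assumes R: "R \<subseteq># F" "reduced R" "R = \<Gamma> + R\<^sub>M + B\<^sub>R"
    and p: "left_part p \<Gamma>" "1 \<le> p" "p \<le> n"
    and RM: "set_mset R\<^sub>M \<subseteq> C ` {p + 1..<n}" "of_type dot R\<^sub>M ts"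
    and BR: "B\<^sub>R \<in> {{#}, {#Cn'#}, {#Cn''#}, {#Cn', Cn''#}}"
  shows "ADER dot F R"
proof -
  have \<Gamma>: "set_mset \<Gamma> \<subseteq> {C0', C0''} \<union> C ` {..<p}"
    using p by (intro set_mset_left_part)
  have B: "set_mset B\<^sub>R \<subseteq> {Cn', Cn''}" using BR by auto
  obtain ss where ss: "of_type dot \<Gamma> ss"
    by (rule left_part_cases[OF p]; blast)
  obtain us where us: "of_type dot B\<^sub>R us"
    by (rule of_type_right_leaves[OF BR])
  have "of_type dot (\<Gamma> + R\<^sub>M) (ss @ ts)"
  proof (rule of_type_appendI)
    have "({C0', C0''} \<union> C ` {..<p}) \<inter> C ` {p + 1..<n} = {}"
      using p(3) by auto
    then show "set_mset \<Gamma> \<inter> set_mset R\<^sub>M = {}"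
      using \<Gamma> RM(1) by blast
    show "\<not> adj D E" if "D \<in># \<Gamma>" "E \<in># R\<^sub>M" for D E
    proof -
      from subsetD[OF RM(1) that(2)] obtain j where "E = C j" "p < j" "j < n" by auto
      from subsetD[OF \<Gamma> that(1)] consider "D \<in> {C0', C0''}" | i where "D = C i" "i < p"
        by blast
      then show ?thesis using \<open>E = C j\<close> \<open>p < j\<close> \<open>j < n\<close> p(3) by cases auto
    qed
  qed (rule ss RM(2))+
  from this us have "of_type dot (\<Gamma> + R\<^sub>M + B\<^sub>R) ((ss @ ts) @ us)"
  proof (rule of_type_appendI)
    have "C ` {..<p} \<subseteq> C ` {..<n}" "C ` {p + 1..<n} \<subseteq> C ` {..<n}" using p(3) by auto
    \<comment> \<open>All central curves used so far have index below \<open>n\<close>, while right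
      leaves meet only \<open>C n\<close>.\<close>
    then have A: "set_mset (\<Gamma> + R\<^sub>M) \<subseteq> {C0', C0''} \<union> C ` {..<n}"
      unfolding set_mset_union
      by (intro Un_least order_trans[OF \<Gamma> Un_mono] order_trans[OF RM(1) le_supI2] order_refl)
    have "({C0', C0''} \<union> C ` {..<n}) \<inter> {Cn', Cn''} = {}" by auto
    with Int_mono[OF A B] show "set_mset (\<Gamma> + R\<^sub>M) \<inter> set_mset B\<^sub>R = {}"
      by (simp only: subset_empty)
    show "\<not> adj D E" if "D \<in># \<Gamma> + R\<^sub>M" "E \<in># B\<^sub>R" for D E
    proof -
      have E: "E \<in> {Cn', Cn''}" using subsetD[OF B that(2)] .
      from subsetD[OF A that(1)] consider "D \<in> {C0', C0''}" | i where "D = C i" "i < n"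
        by blast
      then show ?thesis using E by cases auto
    qed
  qed
  with R show ?thesis unfolding ADER_def by blast
qed

end

lemma separated_subchains_subset:
  assumes "separated_subchains C lo hi ls R"
  shows "set_mset R \<subseteq> C ` {lo..<hi}"
proof -
  obtain as where as: "\<forall>i < length ls. ls ! i \<ge> 1 \<and> lo \<le> as ! i \<and> as ! i + ls ! i \<le> hi"
    and R: "R = (\<Sum>i < length ls. chain C (as ! i) (ls ! i))"
    using assms unfolding separated_subchains_def by blast
  show ?thesis
  proof
    fix D assume "D \<in># R"
    then obtain i where i: "i < length ls" and "D \<in># chain C (as ! i) (ls ! i)"
      unfolding R by (auto simp: set_mset_sum)
    moreover from this(2) obtain j where "D = C j" "as ! i \<le> j" "j < as ! i + ls ! i"
      by (auto simp: chain_def)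
    moreover have "lo \<le> as ! i" "as ! i + ls ! i \<le> hi" using as i by blast+
    ultimately have "lo \<le> j" "j < hi" by linarith+
    with \<open>D = C j\<close> show "D \<in> C ` {lo..<hi}" by simp
  qed
qed

theorem proposition11p5:
  fixes dot :: "'c \<Rightarrow> 'c \<Rightarrow> int"
    and n :: nat
    and C :: "nat \<Rightarrow> 'c"
    and C0' C0'' Cn' Cn'' :: 'c
    and F :: "'c multiset"
  assumes "I_star_fiber dot n C C0' C0'' Cn' Cn'' F"
  shows
    "(\<forall>R \<Gamma> R\<^sub>M B\<^sub>R c.
        ADER dot F R \<and> C 0 \<in># R \<and> C n \<notin># R \<and>
        \<Gamma> = component_of dot R (C 0) \<and>
        c = central_count C n \<Gamma> \<and>
        R\<^sub>M = filter_mset (\<lambda>D. D \<in> C ` {0..n}) (R - \<Gamma>) \<and>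
        B\<^sub>R = filter_mset (\<lambda>D. D \<in> {Cn', Cn''}) R
        \<longrightarrow>
        (R = \<Gamma> + R\<^sub>M + B\<^sub>R \<and>
         set_mset R\<^sub>M \<subseteq> C ` {c + 1..<n} \<and>
         B\<^sub>R \<in> {{#}, {#Cn'#}, {#Cn''#}, {#Cn', Cn''#}}) \<and>
        (R\<^sub>M = {#} \<or>
         (\<exists>ls. ls \<noteq> [] \<and> (\<forall>l \<in> set ls. l \<ge> 1) \<and>
            of_type dot R\<^sub>M (map DynA ls) \<and>
            sum_list ls + length ls \<le> n - c)) \<and>
        ((\<exists>p. 1 \<le> p \<and> p \<le> n \<and> \<Gamma> = chain C 0 p \<and>
            of_type dot \<Gamma> [DynA p] \<and> c = p) \<or>
         (\<exists>L p. L \<in> {C0', C0''} \<and> 1 \<le> p \<and> p \<le> n \<and> \<Gamma> = {#L#} + chain C 0 p \<and>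
            of_type dot \<Gamma> [DynA (p + 1)] \<and> c = p) \<or>
         (\<Gamma> = {#C0', C 0, C0''#} \<and>
            A3_special n C C0' C0'' Cn' Cn'' \<Gamma> \<and> of_type dot \<Gamma> [DynA 3] \<and> c = 1) \<or>
         (\<exists>p. 2 \<le> p \<and> p \<le> n \<and> \<Gamma> = {#C0', C0''#} + chain C 0 p \<and>
            of_type dot \<Gamma> [DynD (p + 2)] \<and> c = p)))
     \<and>
     (\<forall>R \<Gamma> R\<^sub>M B\<^sub>R c.
        R \<subseteq># F \<and> reduced R \<and> R = \<Gamma> + R\<^sub>M + B\<^sub>R \<and>
        ((\<exists>p. 1 \<le> p \<and> p \<le> n \<and> \<Gamma> = chain C 0 p) \<or>
         (\<exists>L p. L \<in> {C0', C0''} \<and> 1 \<le> p \<and> p \<le> n \<and> \<Gamma> = {#L#} + chain C 0 p) \<or>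
         \<Gamma> = {#C0', C 0, C0''#} \<or>
         (\<exists>p. 2 \<le> p \<and> p \<le> n \<and> \<Gamma> = {#C0', C0''#} + chain C 0 p)) \<and>
        c = central_count C n \<Gamma> \<and>
        (R\<^sub>M = {#} \<or>
         (\<exists>ls. ls \<noteq> [] \<and> separated_subchains C (c + 1) n ls R\<^sub>M \<and>
            of_type dot R\<^sub>M (map DynA ls) \<and>
            sum_list ls + length ls \<le> n - c)) \<and>
        B\<^sub>R \<in> {{#}, {#Cn'#}, {#Cn''#}, {#Cn', Cn''#}}
        \<longrightarrow> ADER dot F R)"
proof -
  interpret i_star dot n C C0' C0'' Cn' Cn'' F
    by unfold_locales (rule assms)
  show ?thesis
  proof ((rule conjI; intro allI impI; elim conjE), goal_cases)
    case (1 R \<Gamma> R\<^sub>M B\<^sub>R c)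
    then have "R \<subseteq># F" "reduced R" by (auto simp: ADER_def)
    from ADER_structure[OF this 1(2-4,6,7)] obtain p where
      p: "1 \<le> p" "p \<le> n" "left_part p \<Gamma>" and decomp: "R = \<Gamma> + R\<^sub>M + B\<^sub>R"
      and RM: "set_mset R\<^sub>M \<subseteq> C ` {p + 1..<n}"
      and BR: "B\<^sub>R \<in> {{#}, {#Cn'#}, {#Cn''#}, {#Cn', Cn''#}}" .
    have c: "c = p" using central_count_left_part[OF p(3,1,2)] 1(5) by simp
    obtain S where S: "S \<subseteq> {p + 1..<n}" "set_mset R\<^sub>M = C ` S"
      using RM by (rule subset_imageE)
    \<comment> \<open>With \<open>a = p + 1\<close> and \<open>b = n\<close> the bound
      \<open>b + 1 - a\<close> becomes \<open>n - p\<close>.\<close>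
    from of_type_central[OF S(2,1)] obtain ls where ls: "\<forall>l \<in> set ls. l \<ge> 1"
      "of_type dot R\<^sub>M (map DynA ls)" "sum_list ls + length ls \<le> n - p"
      by auto
    have "R\<^sub>M = {#} \<or> (\<exists>ls. ls \<noteq> [] \<and> (\<forall>l \<in> set ls. l \<ge> 1) \<and>
        of_type dot R\<^sub>M (map DynA ls) \<and> sum_list ls + length ls \<le> n - c)"
    proof (cases "R\<^sub>M = {#}")
      case False
      with ls(2) have "ls \<noteq> []" by (auto simp: of_type_Nil)
      with ls show ?thesis unfolding c by (intro disjI2 exI[of _ ls] conjI)
    qed simp
    moreover have "(\<exists>p. 1 \<le> p \<and> p \<le> n \<and> \<Gamma> = chain C 0 p \<and>
          of_type dot \<Gamma> [DynA p] \<and> c = p) \<or>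
        (\<exists>L p. L \<in> {C0', C0''} \<and> 1 \<le> p \<and> p \<le> n \<and> \<Gamma> = {#L#} + chain C 0 p \<and>
          of_type dot \<Gamma> [DynA (p + 1)] \<and> c = p) \<or>
        (\<Gamma> = {#C0', C 0, C0''#} \<and>
          A3_special n C C0' C0'' Cn' Cn'' \<Gamma> \<and> of_type dot \<Gamma> [DynA 3] \<and> c = 1) \<or>
        (\<exists>p. 2 \<le> p \<and> p \<le> n \<and> \<Gamma> = {#C0', C0''#} + chain C 0 p \<and>
          of_type dot \<Gamma> [DynD (p + 2)] \<and> c = p)"
      using p(3,1,2)
    proof (cases rule: left_part_cases)
      case chain
      with p c show ?thesis by (intro disjI1 exI[of _ p] conjI)
    next
      case (leaf L)
      with p c show ?thesis
        by - (rule disjI2, rule disjI1, intro exI[of _ L] exI[of _ p] conjI)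
    next
      case A3
      with c show ?thesis
        by - (rule disjI2, rule disjI2, rule disjI1, simp add: A3_special_def)
    next
      case D
      with p c show ?thesis
        by - (rule disjI2, rule disjI2, rule disjI2, intro exI[of _ p] conjI)
    qed
    moreover have "set_mset R\<^sub>M \<subseteq> C ` {c + 1..<n}" using RM c by simp
    ultimately show ?case using decomp BR by (intro conjI)
  next
    case (2 R \<Gamma> R\<^sub>M B\<^sub>R c)
    from 2(4) have "\<exists>p. left_part p \<Gamma> \<and> 1 \<le> p \<and> p \<le> n"
    proof (elim disjE exE conjE)
      assume "\<Gamma> = {#C0', C 0, C0''#}"
      \<comment> \<open>The special configuration contains the single central curve
        \<open>C 0\<close>, so the witness is 1, and \<open>1 \<le> n\<close> holds in every fiber
        of this type.\<close>
      then show ?thesis using n_pos by (intro exI[of _ 1]) (simp add: left_part_def)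
    next
      fix p assume "2 \<le> p" "p \<le> n" "\<Gamma> = {#C0', C0''#} + chain C 0 p"
      then show ?thesis by (intro exI[of _ p]) (simp add: left_part_def)
    qed (auto simp: left_part_def)
    then obtain p where p: "left_part p \<Gamma>" "1 \<le> p" "p \<le> n" by blast
    have c: "c = p" using central_count_left_part[OF p] 2(5) by simp
    from 2(6) obtain ts where ts: "set_mset R\<^sub>M \<subseteq> C ` {p + 1..<n}" "of_type dot R\<^sub>M ts"
    proof (elim disjE exE conjE)
      assume "R\<^sub>M = {#}"
      then show thesis by (intro that[of "[]"]) (simp_all add: of_type_Nil)
    next
      fix ls assume "separated_subchains C (c + 1) n ls R\<^sub>M" "of_type dot R\<^sub>M (map DynA ls)"
      from separated_subchains_subset[OF this(1)] this(2) show thesis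
        unfolding c by (rule that)
    qed
    show ?case by (rule ADER_left_part[OF 2(1-3) p ts 2(7)])
  qed
qed

end
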